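(* For any graph $G$ of order $n$ (with $n\ge 1$) and maximum degree $\Delta$, with complement $\overline{G}$, \[ \operatorname{st}_{\gamma_{st}}(G)+\operatorname{st}_{\gamma_{st}}(\overline{G})\le 2n-\frac{n}{n-\Delta}+2 . \]
   Context: All graphs are finite, simple and undirected. For a graph $G=(V,E)$, a set $D\subseteq V$ is a strong dominating set if every vertex $v\in V\setminus D$ is adjacent to some $u\in D$ with $\deg(v)\le\deg(u)$ (degrees taken in $G$). The strong domination number $\gamma_{st}(G)$ is the minimum size of a strong dominating set; the graph with no vertices has $\gamma_{st}=0$. For $S\subseteq V$, $G-S$ is the graph obtained by deleting the vertices of $S$. The stability of the strong domination number is $\operatorname{st}_{\gamma_{st}}(G)=\min\{|S| : S\subseteq V,\ \gamma_{st}(G-S)\ne\gamma_{st}(G)\}$ (the choice $S=V$ is allowed, so that $\operatorname{st}_{\gamma_{st}}(K_n)=n$). *)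

theory Defs
  imports Complex_Main "Graph_Theory.Graph_Theory"
begin

text \<open>
  Finite simple undirected graphs are the library's \<open>pair_graph\<close>s: finite, loop-free, symmetric
  digraphs without parallel arcs, an edge $uv$ being the two arcs $(u,v)$ and $(v,u)$.  In such a
  graph \<open>out_degree G v\<close> is the number of neighbours of \<open>v\<close>, i.e. its degree.  The definitions below
  live on \<open>pre_digraph\<close> so that they apply to the library's induced subgraphs \<open>G \<restriction> S\<close>.
\<close>

definition max_degree :: "('a,'b) pre_digraph \<Rightarrow> nat" where
  "max_degree G = Max (out_degree G ` verts G)"

definition graph_complement :: "'a pair_pre_digraph \<Rightarrow> 'a pair_pre_digraph" where
  "graph_complement G = \<lparr> pverts = pverts G,
     parcs = {(u, v). u \<in> pverts G \<and> v \<in> pverts G \<and> u \<noteq> v \<and> (u, v) \<notin> parcs G} \<rparr>"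

definition strong_dominating_set :: "('a,'b) pre_digraph \<Rightarrow> 'a set \<Rightarrow> bool" where
  "strong_dominating_set G D \<longleftrightarrow> D \<subseteq> verts G \<and>
     (\<forall>v \<in> verts G - D. \<exists>u \<in> D. u \<rightarrow>\<^bsub>G\<^esub> v \<and> out_degree G v \<le> out_degree G u)"

definition strong_domination_number :: "('a,'b) pre_digraph \<Rightarrow> nat" where
  "strong_domination_number G = (LEAST k. \<exists>D. strong_dominating_set G D \<and> card D = k)"

definition delete_verts :: "('a,'b) pre_digraph \<Rightarrow> 'a set \<Rightarrow> ('a,'b) pre_digraph" where
  "delete_verts G S = G \<restriction> (verts G - S)"

text \<open>
  The set \<open>S = verts G\<close> is allowed.  The minimum exists for every finite nonempty graph; for the graph
  without vertices no \<open>S\<close> qualifies and the value is unspecified.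
\<close>
definition strong_domination_stability :: "('a,'b) pre_digraph \<Rightarrow> nat" where
  "strong_domination_stability G =
     (LEAST k. \<exists>S \<subseteq> verts G.
        strong_domination_number (delete_verts G S) \<noteq> strong_domination_number G \<and> card S = k)"

lemma pair_graph_graph_complement:
  assumes "pair_graph G"
  shows "pair_graph (graph_complement G)"
proof -
  interpret pair_graph G by fact
  have "parcs (graph_complement G) \<subseteq> pverts G \<times> pverts G"
    by (auto simp: graph_complement_def)
  then have fin: "finite (parcs (graph_complement G))"
    by (rule finite_subset) simp
  have "sym (parcs G)"
    using pair_sym_arcs by (simp add: symmetric_def)
  then have "sym (parcs (graph_complement G))"
    by (auto simp: graph_complement_def sym_def)
  then show ?thesis
    using fin by unfold_locales (auto simp: graph_complement_def symmetric_def)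
qed

end

(* The bound follows from st(G) <= n together with st(H) <= deg v + 1 for every vertex v of H: once
   the neighbours of v are deleted, v is isolated, and deleting it as well lowers the strong
   domination number, so one of the two deletions changes its value.  For H the complement of G and
   v of maximum degree in G, deg v = n - 1 - \<Delta> in H, so the sum is at most
   2 n - \<Delta>, and (\<Delta> + 1)(n - \<Delta>) >= n. *)

theory Submission
  imports Defs
begin

lemma strong_domination_number_le:
  "strong_dominating_set G D \<Longrightarrow> strong_domination_number G \<le> card D"
  unfolding strong_domination_number_def by (rule Least_le) blast

text \<open>The full vertex set always qualifies, so the \<open>LEAST\<close> is attained.\<close>

lemma minimum_strong_dominating_set:
  obtains D where "strong_dominating_set G D" "card D = strong_domination_number G"
proof -
  have "strong_dominating_set G (verts G)"
    by (simp add: strong_dominating_set_def)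
  then have "\<exists>k D. strong_dominating_set G D \<and> card D = k"
    by blast
  then have "\<exists>D. strong_dominating_set G D \<and> card D = strong_domination_number G"
    unfolding strong_domination_number_def by (rule LeastI_ex)
  then show thesis
    using that by blast
qed

lemma strong_domination_number_no_verts:
  "verts G = {} \<Longrightarrow> strong_domination_number G = 0"
  using strong_domination_number_le[of G "{}"] by (simp add: strong_dominating_set_def)

lemma (in fin_digraph) strong_domination_number_pos:
  assumes "verts G \<noteq> {}"
  shows "strong_domination_number G > 0"
proof -
  obtain D where D: "strong_dominating_set G D" "card D = strong_domination_number G"
    by (rule minimum_strong_dominating_set)
  then have "finite D" "D \<noteq> {}"
    using assms by (auto simp: strong_dominating_set_def intro: finite_subset[OF _ finite_verts])
  then show ?thesis
    using D(2) by (metis card_gt_0_iff)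
qed

text \<open>An isolated vertex has no neighbour to dominate it and dominates nothing else, so a
  minimum set contains it and, once it is removed, still dominates the rest.\<close>

lemma (in fin_digraph) strong_domination_number_delete_isolated:
  assumes "v \<in> verts G"
    and isolated: "\<And>e. e \<in> arcs G \<Longrightarrow> tail G e \<noteq> v \<and> head G e \<noteq> v"
  shows "strong_domination_number (delete_verts G {v}) < strong_domination_number G"
proof -
  let ?H = "delete_verts G {v}"
  obtain D where D: "strong_dominating_set G D" "card D = strong_domination_number G"
    by (rule minimum_strong_dominating_set)
  have "finite D"
    using D(1) by (auto simp: strong_dominating_set_def intro: finite_subset[OF _ finite_verts])
  have not_adj: "\<not> w \<rightarrow> v" "\<not> v \<rightarrow> w" for w
    using isolated by (auto simp: arcs_ends_conv)
  then have "v \<in> D"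
    using D(1) \<open>v \<in> verts G\<close> unfolding strong_dominating_set_def by blast
  \<comment> \<open>No arc meets \<open>v\<close>, so only the vertex set shrinks: degrees, and with
    them the degree comparisons in strong domination, survive the deletion.\<close>
  have arcs: "arcs ?H = arcs G"
    using isolated by (auto simp: delete_verts_def)
  have degree: "out_degree ?H w = out_degree G w" for w
    by (simp add: out_degree_def out_arcs_def arcs) (simp add: delete_verts_def)
  have ends: "arcs_ends ?H = arcs_ends G"
    by (simp add: arcs_ends_conv arcs) (simp add: delete_verts_def)
  have "\<exists>u \<in> D - {v}. u \<rightarrow> w \<and> out_degree G w \<le> out_degree G u"
    if "w \<in> verts G - D" for w
  proof -
    from D(1) that obtain u where "u \<in> D" "u \<rightarrow> w" "out_degree G w \<le> out_degree G u"
      unfolding strong_dominating_set_def by blast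
    moreover have "u \<noteq> v"
      using not_adj(2) \<open>u \<rightarrow> w\<close> by blast
    ultimately show ?thesis
      by blast
  qed
  then have "strong_dominating_set ?H (D - {v})"
    using D(1) \<open>v \<in> D\<close> unfolding strong_dominating_set_def ends degree
    by (auto simp: delete_verts_def)
  then have "strong_domination_number ?H \<le> card (D - {v})"
    by (rule strong_domination_number_le)
  also have "\<dots> < card D"
    using \<open>finite D\<close> \<open>v \<in> D\<close> by (rule card_Diff1_less)
  finally show ?thesis
    using D(2) by simp
qed

lemma strong_domination_stability_le:
  assumes "S \<subseteq> verts G"
    and "strong_domination_number (delete_verts G S) \<noteq> strong_domination_number G"
  shows "strong_domination_stability G \<le> card S"
  unfolding strong_domination_stability_def using assms by (intro Least_le) blast

text \<open>Deleting every vertex drops a positive value to 0, so the full vertex set is an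
  admissible choice.\<close>

lemma (in fin_digraph) strong_domination_stability_le_card_verts:
  assumes "verts G \<noteq> {}"
  shows "strong_domination_stability G \<le> card (verts G)"
proof (rule strong_domination_stability_le)
  show "strong_domination_number (delete_verts G (verts G)) \<noteq> strong_domination_number G"
    using strong_domination_number_pos[OF assms]
    by (simp add: strong_domination_number_no_verts delete_verts_def)
qed simp

text \<open>Lets the deletion of a neighbourhood followed by that of its centre count as a single
  deletion.\<close>

lemma delete_verts_delete_verts:
  "delete_verts (delete_verts G S) T = delete_verts G (S \<union> T)"
  by (auto simp: delete_verts_def induce_subgraph_def)

lemma (in graph) strong_domination_stability_le_degree:
  assumes "v \<in> verts G"
  shows "strong_domination_stability G \<le> out_degree G v + 1"
proof -
  define N where "N = head G ` out_arcs G v"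
  have N: "N \<subseteq> verts G" "v \<notin> N"
    using no_loops by (auto simp: N_def)
  have "finite N"
    using N(1) finite_verts by (rule finite_subset)
  have card_N: "card N \<le> out_degree G v"
    unfolding N_def out_degree_def by (rule card_image_le) (rule finite_out_arcs)
  interpret H: fin_digraph "delete_verts G N"
    unfolding delete_verts_def
    by (intro fin_digraph_subgraph subgraph_induce_subgraphI) auto
  \<comment> \<open>\<open>N\<close> collects heads of arcs leaving \<open>v\<close>; by symmetry it
    also contains the tails of arcs entering \<open>v\<close>, so deleting \<open>N\<close> isolates
    \<open>v\<close>.\<close>
  have into_v: "tail G e \<in> N" if "e \<in> arcs G" "head G e = v" for e
  proof -
    have "\<exists>e' \<in> arcs G. tail G e = head G e' \<and> head G e = tail G e'"
      using sym_arcs that(1) unfolding symmetric_conv by (rule bspec)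
    then show ?thesis
      using that(2) by (auto simp: N_def)
  qed
  have "strong_domination_number (delete_verts G (N \<union> {v}))
      < strong_domination_number (delete_verts G N)"
    unfolding delete_verts_delete_verts[symmetric]
  proof (rule H.strong_domination_number_delete_isolated)
    show "v \<in> verts (delete_verts G N)"
      using assms N by (simp add: delete_verts_def)
    show "tail (delete_verts G N) e \<noteq> v \<and> head (delete_verts G N) e \<noteq> v"
      if "e \<in> arcs (delete_verts G N)" for e
      using that into_v by (auto simp: delete_verts_def N_def)
  qed
  \<comment> \<open>Two different values cannot both equal that of \<open>G\<close>.\<close>
  then consider
      "strong_domination_number (delete_verts G N) \<noteq> strong_domination_number G"
    | "strong_domination_number (delete_verts G (N \<union> {v})) \<noteq> strong_domination_number G"
    by linarith
  then show ?thesis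
  proof cases
    case 1
    then show ?thesis
      using strong_domination_stability_le[OF N(1)] card_N by fastforce
  next
    case 2
    have "strong_domination_stability G \<le> card (N \<union> {v})"
      using 2 N(1) assms by (intro strong_domination_stability_le) auto
    also have "\<dots> = card N + 1"
      using \<open>finite N\<close> N(2) by simp
    finally show ?thesis
      using card_N by simp
  qed
qed

text \<open>The vertices other than \<open>v\<close> split into its neighbours in the graph and
  those in the complement; the 1 counts \<open>v\<close> itself.\<close>

lemma (in pair_graph) out_degree_graph_complement:
  assumes "v \<in> pverts G"
  shows "out_degree (with_proj G) v + out_degree (with_proj (graph_complement G)) v + 1
    = card (pverts G)"
proof -
  define N where "N = {w. (v, w) \<in> parcs G}"
  have N: "N \<subseteq> pverts G - {v}"
    using wellformed no_loops by (force simp: N_def)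
  \<comment> \<open>Degrees count arcs; the injection \<open>Pair v\<close> turns them into counts
    of neighbours.\<close>
  have "out_arcs (with_proj G) v = Pair v ` N"
    by (auto simp: out_arcs_def N_def)
  then have "out_degree (with_proj G) v = card N"
    by (simp add: out_degree_def card_image inj_on_def)
  moreover have "out_arcs (with_proj (graph_complement G)) v = Pair v ` (pverts G - {v} - N)"
    using assms by (auto simp: out_arcs_def graph_complement_def N_def)
  then have "out_degree (with_proj (graph_complement G)) v = card (pverts G - {v} - N)"
    by (simp add: out_degree_def card_image inj_on_def)
  moreover have "card (pverts G - {v} - N) + card N = card (pverts G - {v})"
    using N by (simp add: card_Diff_subset card_mono finite_subset[OF N])
  moreover have "card (pverts G - {v}) + 1 = card (pverts G)"
    using card_Suc_Diff1[OF pair_finite_verts assms] by simp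
  ultimately show ?thesis
    by simp
qed

theorem theorem3p5:
  fixes G :: "'a pair_pre_digraph" and n \<Delta> :: nat
  assumes "pair_graph G"
    and "n = card (pverts G)" and "n \<ge> 1"
    and "\<Delta> = max_degree (with_proj G)"
  shows "real (strong_domination_stability (with_proj G))
       + real (strong_domination_stability (with_proj (graph_complement G)))
       \<le> 2 * real n - real n / (real n - real \<Delta>) + 2"
proof -
  interpret pair_graph G by fact
  interpret C: pair_graph "graph_complement G"
    using assms(1) by (rule pair_graph_graph_complement)
  have nonempty: "pverts G \<noteq> {}"
    using assms(2,3) by auto
  \<comment> \<open>A vertex of maximum degree in \<open>G\<close> has the smallest degree in the
    complement, where the degree bound is therefore strongest.\<close>
  have "\<Delta> \<in> out_degree (with_proj G) ` pverts G"
    unfolding assms(4) max_degree_def using nonempty by (simp add: Max_in)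
  then obtain v where v: "v \<in> pverts G" "out_degree (with_proj G) v = \<Delta>"
    by blast
  have degrees: "\<Delta> + out_degree (with_proj (graph_complement G)) v + 1 = n"
    using out_degree_graph_complement[OF v(1)] v(2) assms(2) by simp
  have "strong_domination_stability (with_proj (graph_complement G))
      \<le> out_degree (with_proj (graph_complement G)) v + 1"
    using v(1) by (intro C.strong_domination_stability_le_degree) (simp add: graph_complement_def)
  moreover have "strong_domination_stability (with_proj G) \<le> n"
    using strong_domination_stability_le_card_verts nonempty assms(2) by simp
  ultimately have "strong_domination_stability (with_proj G)
      + strong_domination_stability (with_proj (graph_complement G)) + \<Delta> \<le> 2 * n"
    using degrees by linarith
  then have "real (strong_domination_stability (with_proj G))
      + real (strong_domination_stability (with_proj (graph_complement G))) \<le> 2 * real n - real \<Delta>"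
    by linarith
  moreover have "real n / (real n - real \<Delta>) \<le> real \<Delta> + 1"
  proof -
    have "real \<Delta> + 1 \<le> real n"
      using degrees by linarith
    \<comment> \<open>This product equals (\<Delta> + 1)(n - \<Delta>) - n, and n - \<Delta> \<ge> 1
      allows division by n - \<Delta>.\<close>
    then have "0 \<le> real \<Delta> * (real n - real \<Delta> - 1)"
      by simp
    then show ?thesis
      using \<open>real \<Delta> + 1 \<le> real n\<close> by (simp add: divide_le_eq algebra_simps)
  qed
  \<comment> \<open>The two estimates give the bound even with 1 in place of the final 2.\<close>
  ultimately show ?thesis
    by linarith
qed

end
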